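(* Assume that the waveguide is initially in its vacuum state, $|\Psi(0)\rangle=|\psi(0)\rangle\otimes|\mathbf0\rangle$, and that $\mathrm{d}t<z_1^{(1)}/c$. Then the non-Markovian It\^o rule for atoms coupled to a semi-infinite waveguide via multiple points reads $$\mathrm{d}B_{\rm m,in}^{(j)}(t)\,\mathrm{d}B_{\rm m,in}^{(l)\dagger}(t)=\int_t^{t+\mathrm{d}t}\int_t^{t+\mathrm{d}t}\left[b_{\rm m,in}^{(j)}(s),b_{\rm m,in}^{(l)\dagger}(\mu)\right]\mathrm{d}s\,\mathrm{d}\mu,$$ where the commutator is $$\left[b_{\rm m,in}^{(j)}(s),b_{\rm m,in}^{(l)\dagger}(\mu)\right]=\int_0^s\tilde\eta_j^*(s-\nu)\,\tilde\eta_l(\mu-\nu)\,\mathrm{d}\nu,$$ with $$\tilde\eta_j(\mu-\nu)=\sum_{n=1}^{\mathbf n_j}\left[\sqrt{\gamma_{jR}^{(n)}}\,\delta\!\left(\mu-\nu-\frac{z_j^{(n)}}{c}\right)-\sqrt{\gamma_{jL}^{(n)}}\,\delta\!\left(\mu-\nu+\frac{z_j^{(n)}}{c}\right)\right],$$ and $\mathrm{d}B_{\rm m,in}^{(j)}\mathrm{d}B_{\rm m,in}^{(l)}=\mathrm{d}B_{\rm m,in}^{(j)\dagger}\mathrm{d}B_{\rm m,in}^{(l)\dagger}=\mathrm{d}B_{\rm m,in}^{(l)\dagger}\mathrm{d}B_{\rm m,in}^{(j)}=0$.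
   Context: $N$ two-level atoms are coupled to a semi-infinite waveguide closed by a mirror; atom $j$ is coupled at the points $0<z_j^{(1)}<z_j^{(2)}<\dots<z_j^{(\mathbf n_j)}$ (distances to the mirror), with coupling strengths $\gamma_{jR}^{(n)},\gamma_{jL}^{(n)}\ge0$ to the right- and left-propagating modes at its $n$th point; $c>0$ is the propagation speed. The input field satisfies $[b_{\rm in}(t),b_{\rm in}^\dagger(t')]=\delta(t-t')$, $[b_{\rm in}(t),b_{\rm in}(t')]=0$, and annihilates the vacuum $|\mathbf0\rangle$ of the waveguide; $|\psi(0)\rangle$ is the initial atomic state. The $j$th input noise channel is $$b_{\rm m,in}^{(j)}(t)=\sum_{n=1}^{\mathbf n_j}\left[\sqrt{\gamma_{jR}^{(n)}}\,b_{\rm in}\!\left(t-z_j^{(n)}/c\right)-\sqrt{\gamma_{jL}^{(n)}}\,b_{\rm in}\!\left(t+z_j^{(n)}/c\right)\right],$$ i.e. ${b_{\rm m,in}^{(j)}}^{\dagger}(t)$ is the convolution of $\tilde\eta_j$ with $b_{\rm in}^\dagger$. Convention: integrals of the form $\int_0^t\delta(t-\nu\mp z/c)f(\nu)\,\mathrm{d}\nu$ are evaluated formally as $f(t\mp z/c)$. The increments are $\mathrm{d}B_{\rm m,in}^{(j)}(t)=\int_t^{t+\mathrm{d}t}b_{\rm m,in}^{(j)}(s)\,\mathrm{d}s$ with $\mathrm{d}t>0$ a small time step. Products of increments are It\^o products with respect to the vacuum state. *)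

theory Defs
  imports "HOL-Analysis.Analysis"
begin

section \<open>Complex pre-Hilbert spaces\<close>

(* No completeness: unbounded field operators live on a common invariant domain, for example the
   finite-particle vectors of a Fock space. The form is conjugate-linear in its first argument. *)
class complex_pre_hilbert = ab_group_add +
  fixes scaleC :: "complex \<Rightarrow> 'a \<Rightarrow> 'a" (infixr "*\<^sub>C" 75)
    and cinner :: "'a \<Rightarrow> 'a \<Rightarrow> complex"
  assumes scaleC_add_right: "a *\<^sub>C (x + y) = a *\<^sub>C x + a *\<^sub>C y"
    and scaleC_add_left: "(a + a') *\<^sub>C x = a *\<^sub>C x + a' *\<^sub>C x"
    and scaleC_scaleC: "a *\<^sub>C a' *\<^sub>C x = (a * a') *\<^sub>C x"
    and scaleC_one: "1 *\<^sub>C x = x"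
    and cinner_commute: "cinner x y = cnj (cinner y x)"
    and cinner_add_right: "cinner x (y + y') = cinner x y + cinner x y'"
    and cinner_scaleC_right: "cinner x (a *\<^sub>C y) = a * cinner x y"
    and cinner_ge_zero: "0 \<le> Re (cinner x x)"
    and cinner_eq_zero_iff: "cinner x x = 0 \<longleftrightarrow> x = 0"

interpretation scaleC: vector_space "scaleC :: complex \<Rightarrow> 'a \<Rightarrow> 'a::complex_pre_hilbert"
  by unfold_locales (simp_all add: scaleC_add_right scaleC_add_left scaleC_scaleC scaleC_one)

definition commutator :: "('a \<Rightarrow> 'a::minus) \<Rightarrow> ('a \<Rightarrow> 'a) \<Rightarrow> 'a \<Rightarrow> 'a" where
  "commutator X Y = (\<lambda>v. X (Y v) - Y (X v))"

section \<open>The input field\<close>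

definition L2 :: "(real \<Rightarrow> complex) set" where
  "L2 = {f \<in> borel_measurable lborel. integrable lborel (\<lambda>x. (cmod (f x))\<^sup>2)}"

(* The field is an operator-valued distribution: b f stands for the integral of f(t) b_in(t) dt and
   bd f for the integral of f(t) b_in^dagger(t) dt, both linear in f. The relation
   [b_in(t), b_in^dagger(t')] = delta(t - t'), tested with f(t) g(t'), becomes ccr. *)
locale input_field =
  fixes b bd :: "(real \<Rightarrow> complex) \<Rightarrow> 'h \<Rightarrow> 'h::complex_pre_hilbert"
    and vac :: 'h
  assumes b_linear: "f \<in> L2 \<Longrightarrow> Vector_Spaces.linear (*\<^sub>C) (*\<^sub>C) (b f)"
    and bd_linear: "f \<in> L2 \<Longrightarrow> Vector_Spaces.linear (*\<^sub>C) (*\<^sub>C) (bd f)"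
    and b_smear: "f \<in> L2 \<Longrightarrow> g \<in> L2 \<Longrightarrow>
      b (\<lambda>t. \<alpha> * f t + \<beta> * g t) v = \<alpha> *\<^sub>C b f v + \<beta> *\<^sub>C b g v"
    and bd_smear: "f \<in> L2 \<Longrightarrow> g \<in> L2 \<Longrightarrow>
      bd (\<lambda>t. \<alpha> * f t + \<beta> * g t) v = \<alpha> *\<^sub>C bd f v + \<beta> *\<^sub>C bd g v"
    and adjoint: "f \<in> L2 \<Longrightarrow> cinner u (b f v) = cinner (bd (\<lambda>t. cnj (f t)) u) v"
    and ccr: "f \<in> L2 \<Longrightarrow> g \<in> L2 \<Longrightarrow> commutator (b f) (bd g) v = (LINT t|lborel. f t * g t) *\<^sub>C v"
    and ccr_annihilation: "f \<in> L2 \<Longrightarrow> g \<in> L2 \<Longrightarrow> commutator (b f) (b g) v = 0"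
    and vacuum: "f \<in> L2 \<Longrightarrow> b f vac = 0"
    and vacuum_unit: "cinner vac vac = 1"

section \<open>Atoms and coupling points\<close>

(* Atoms are numbered 1..atoms, the coupling points of atom j are numbered 1..points j;
   position j n is the distance to the mirror. *)
record waveguide =
  atoms :: nat
  points :: "nat \<Rightarrow> nat"
  position :: "nat \<Rightarrow> nat \<Rightarrow> real"
  gamma_R :: "nat \<Rightarrow> nat \<Rightarrow> real"
  gamma_L :: "nat \<Rightarrow> nat \<Rightarrow> real"
  speed :: real

definition valid_waveguide :: "waveguide \<Rightarrow> bool" where
  "valid_waveguide w \<longleftrightarrow>
     1 \<le> atoms w \<and> 0 < speed w \<and>
     (\<forall>j\<in>{1..atoms w}.
        1 \<le> points w j \<and> 0 < position w j 1 \<and>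
        strict_mono_on {1..points w j} (position w j) \<and>
        (\<forall>n\<in>{1..points w j}. 0 \<le> gamma_R w j n \<and> 0 \<le> gamma_L w j n))"

definition travel_time :: "waveguide \<Rightarrow> nat \<Rightarrow> nat \<Rightarrow> real" where
  "travel_time w j n = position w j n / speed w"

section \<open>The distributional coupling kernels\<close>

(* A distribution eta(u) is represented by its action on functions: phi is sent to the integral of
   eta(u) phi(u) du. *)
type_synonym distribution = "(real \<Rightarrow> complex) \<Rightarrow> complex"

(* delta(u - a) *)
definition delta :: "real \<Rightarrow> distribution" where
  "delta a \<phi> = \<phi> a"

definition dist_cnj :: "distribution \<Rightarrow> distribution" where
  "dist_cnj \<eta> \<phi> = cnj (\<eta> (\<lambda>u. cnj (\<phi> u)))"

definition eta :: "waveguide \<Rightarrow> nat \<Rightarrow> distribution" where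
  "eta w j \<phi> = (\<Sum>n = 1..points w j.
     complex_of_real (sqrt (gamma_R w j n)) * delta (travel_time w j n) \<phi>
     - complex_of_real (sqrt (gamma_L w j n)) * delta (- travel_time w j n) \<phi>)"

(* The integral of eta(s - nu) F(nu) over 0 <= nu <= s, under the convention that a term
   delta(s - nu - a) of the kernel always contributes F(s - a), whether or not s - a lies
   between 0 and s (for the left-moving terms it never does). *)
definition formal_integral :: "distribution \<Rightarrow> real \<Rightarrow> (real \<Rightarrow> complex) \<Rightarrow> complex" where
  "formal_integral \<eta> s F = \<eta> (\<lambda>u. F (s - u))"

(* The distribution in (s, mu) given by the formal integral over nu of
   cnj eta_j(s - nu) eta_l(mu - nu), tested with f(s) g(mu). The innermost application of eta w l
   is the integral over mu of eta_l(mu - nu) g(mu), a function of nu. *)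
definition eta_kernel ::
    "waveguide \<Rightarrow> nat \<Rightarrow> nat \<Rightarrow> (real \<Rightarrow> complex) \<Rightarrow> (real \<Rightarrow> complex) \<Rightarrow> complex" where
  "eta_kernel w j l f g =
     (LINT s|lborel. f s *
        formal_integral (dist_cnj (eta w j)) s (\<lambda>\<nu>. eta w l (\<lambda>u. g (\<nu> + u))))"

section \<open>Noise channels\<close>

(* With a for the field t |-> a(t), this is t |-> a(t - tau). *)
definition delayed :: "real \<Rightarrow> ((real \<Rightarrow> complex) \<Rightarrow> 'h \<Rightarrow> 'h) \<Rightarrow> (real \<Rightarrow> complex) \<Rightarrow> 'h \<Rightarrow> 'h" where
  "delayed \<tau> a f = a (\<lambda>t. f (t + \<tau>))"

(* noise w b j is b_{m,in}^(j) and, the weights being real, noise w bd j is its adjoint field: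
   see noise_adjoint and noise_convolution below. *)
definition noise :: "waveguide \<Rightarrow> ((real \<Rightarrow> complex) \<Rightarrow> 'h \<Rightarrow> 'h) \<Rightarrow> nat
    \<Rightarrow> (real \<Rightarrow> complex) \<Rightarrow> 'h \<Rightarrow> 'h::complex_pre_hilbert" where
  "noise w a j f v = (\<Sum>n = 1..points w j.
     complex_of_real (sqrt (gamma_R w j n)) *\<^sub>C delayed (travel_time w j n) a f v
     - complex_of_real (sqrt (gamma_L w j n)) *\<^sub>C delayed (- travel_time w j n) a f v)"

definition window :: "real \<Rightarrow> real \<Rightarrow> real \<Rightarrow> complex" where
  "window t dt = indicator {t..t + dt}"

(* The commutator [b_{m,in}^(j)(s), b_{m,in}^(l)^dagger(mu)], a distribution in (s, mu), tested with
   f(s) g(mu). For f = g = window t dt it is the double integral of the commutator over the square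
   [t, t + dt] x [t, t + dt]. *)
definition noise_commutator :: "waveguide \<Rightarrow> ((real \<Rightarrow> complex) \<Rightarrow> 'h \<Rightarrow> 'h)
    \<Rightarrow> ((real \<Rightarrow> complex) \<Rightarrow> 'h \<Rightarrow> 'h) \<Rightarrow> nat \<Rightarrow> nat
    \<Rightarrow> (real \<Rightarrow> complex) \<Rightarrow> (real \<Rightarrow> complex) \<Rightarrow> 'h \<Rightarrow> 'h::complex_pre_hilbert" where
  "noise_commutator w b bd j l f g = commutator (noise w b j f) (noise w bd l g)"

section \<open>Atoms together with the field\<close>

(* A basis state of N two-level atoms is the set S of excited atoms, so a vector of the tensor
   product of the atomic space with the field space is a family of field vectors indexed by the
   subsets of {1..N}. *)
type_synonym 'h joint = "nat set \<Rightarrow> 'h"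

definition joint_inner :: "nat \<Rightarrow> 'h joint \<Rightarrow> 'h::complex_pre_hilbert joint \<Rightarrow> complex" where
  "joint_inner N \<Phi> \<Xi> = (\<Sum>S\<in>Pow {1..N}. cinner (\<Phi> S) (\<Xi> S))"

definition tensor :: "(nat set \<Rightarrow> complex) \<Rightarrow> 'h \<Rightarrow> 'h::complex_pre_hilbert joint" where
  "tensor \<psi> v = (\<lambda>S. \<psi> S *\<^sub>C v)"

definition field_op :: "('h \<Rightarrow> 'h) \<Rightarrow> 'h joint \<Rightarrow> 'h joint" where
  "field_op X \<Phi> = (\<lambda>S. X (\<Phi> S))"

definition atomic_op ::
    "nat \<Rightarrow> (nat set \<Rightarrow> nat set \<Rightarrow> complex) \<Rightarrow> 'h joint \<Rightarrow> 'h::complex_pre_hilbert joint" where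
  "atomic_op N A \<Phi> = (\<lambda>S. \<Sum>T\<in>Pow {1..N}. A S T *\<^sub>C \<Phi> T)"

(* dB w b j t dt is dB_{m,in}^(j)(t), and dB w bd j t dt is its adjoint. *)
definition dB :: "waveguide \<Rightarrow> ((real \<Rightarrow> complex) \<Rightarrow> 'h \<Rightarrow> 'h) \<Rightarrow> nat \<Rightarrow> real \<Rightarrow> real
    \<Rightarrow> 'h joint \<Rightarrow> 'h::complex_pre_hilbert joint" where
  "dB w a j t dt = field_op (noise w a j (window t dt))"

(* Equality of Ito products relative to the initial state Psi: P and Q have the same matrix
   elements between all vectors obtained from Psi by atomic operators. For Psi = psi (x) vacuum this
   says that P and Q have the same vacuum conditional expectation, as operators on the atoms.
   Plain operator equality would be false: a product of two creation increments does not kill the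
   vacuum, only its vacuum expectation vanishes. *)
definition ito_eq :: "nat \<Rightarrow> 'h joint \<Rightarrow> ('h joint \<Rightarrow> 'h joint)
    \<Rightarrow> ('h joint \<Rightarrow> 'h::complex_pre_hilbert joint) \<Rightarrow> bool" where
  "ito_eq N \<Psi> P Q \<longleftrightarrow> (\<forall>A B.
     joint_inner N (atomic_op N A \<Psi>) (P (atomic_op N B \<Psi>))
     = joint_inner N (atomic_op N A \<Psi>) (Q (atomic_op N B \<Psi>)))"

section \<open>The noise channels are adjoint to each other, and convolutions with the kernels\<close>

lemma L2_shift:
  assumes "f \<in> L2" shows "(\<lambda>t. f (t + a)) \<in> L2"
proof -
  have f: "f \<in> borel_measurable borel" "integrable lborel (\<lambda>x. (cmod (f x))\<^sup>2)"
    using assms by (auto simp: L2_def)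
  have "(\<lambda>t. f (t + a)) \<in> borel_measurable borel"
    using f(1) by measurable
  moreover have "integrable lborel (\<lambda>x. (cmod (f (a + 1 * x)))\<^sup>2)"
    using lborel_integrable_real_affine[OF f(2), of 1 a] by simp
  ultimately show ?thesis by (auto simp: L2_def add.commute)
qed

lemma L2_scale:
  assumes "f \<in> L2" shows "(\<lambda>t. c * f t) \<in> L2"
  using assms by (auto simp: L2_def norm_mult power_mult_distrib)

lemma L2_add:
  assumes "f \<in> L2" "g \<in> L2" shows "(\<lambda>t. f t + g t) \<in> L2"
proof -
  have f: "f \<in> borel_measurable borel" "integrable lborel (\<lambda>x. (cmod (f x))\<^sup>2)"
    and g: "g \<in> borel_measurable borel" "integrable lborel (\<lambda>x. (cmod (g x))\<^sup>2)"
    using assms by (auto simp: L2_def)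
  have le: "(cmod (f x + g x))\<^sup>2 \<le> 2 * (cmod (f x))\<^sup>2 + 2 * (cmod (g x))\<^sup>2" for x
  proof -
    have "(cmod (f x + g x))\<^sup>2 \<le> (cmod (f x) + cmod (g x))\<^sup>2"
      by (intro power_mono norm_triangle_ineq) simp
    also have "\<dots> \<le> 2 * (cmod (f x))\<^sup>2 + 2 * (cmod (g x))\<^sup>2"
      using sum_squares_bound[of "cmod (f x)" "cmod (g x)"] by (simp add: power2_sum)
    finally show ?thesis .
  qed
  have "integrable lborel (\<lambda>x. (cmod (f x + g x))\<^sup>2)"
    by (rule Bochner_Integration.integrable_bound[where f = "\<lambda>x. 2 * (cmod (f x))\<^sup>2 + 2 * (cmod (g x))\<^sup>2"])
       (use f g le in \<open>auto intro!: integrable_add\<close>)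
  with f g show ?thesis by (auto simp: L2_def)
qed

lemma L2_zero: "(\<lambda>t. 0) \<in> L2"
  by (auto simp: L2_def)

lemma L2_cnj:
  assumes "f \<in> L2" shows "(\<lambda>t. cnj (f t)) \<in> L2"
proof -
  have "cnj \<in> borel_measurable borel"
    by (intro borel_measurable_continuous_onI continuous_intros)
  from measurable_compose[OF _ this, of f lborel] show ?thesis
    using assms by (auto simp: L2_def)
qed

lemma window_L2: "window t dt \<in> L2"
proof -
  have "(\<lambda>x. (cmod (window t dt x))\<^sup>2) = indicator {t..t + dt}"
    by (auto simp: window_def indicator_def)
  moreover have "integrable lborel (indicator {t..t + dt} :: real \<Rightarrow> real)"
    by (rule integrable_real_indicator) (simp_all add: emeasure_lborel_Icc_eq)
  ultimately show ?thesis
    by (auto simp: L2_def window_def)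
qed

lemma cinner_zero_right: "cinner u (0 :: 'h::complex_pre_hilbert) = 0"
  using cinner_scaleC_right[of u 0 0] by simp

lemma cinner_diff_right: "cinner u (v - v' :: 'h::complex_pre_hilbert) = cinner u v - cinner u v'"
  using cinner_add_right[of u "v - v'" v'] by simp

lemma cinner_sum_right:
  "cinner u (\<Sum>i\<in>I. v i :: 'h::complex_pre_hilbert) = (\<Sum>i\<in>I. cinner u (v i))"
  by (induction I rule: infinite_finite_induct) (simp_all add: cinner_zero_right cinner_add_right)

lemma (in input_field) noise_adjoint:
  assumes "f \<in> L2"
  shows "cinner u (noise w b j f v) = cinner (noise w bd j (\<lambda>t. cnj (f t)) u) v"
proof -
  have adj': "cinner v (bd (\<lambda>t. cnj (f (t + a))) u) = cnj (cinner u (b (\<lambda>t. f (t + a)) v))" for a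
    using adjoint[OF L2_shift[OF assms, of a], of u v] by (metis cinner_commute)
  have "cinner v (noise w bd j (\<lambda>t. cnj (f t)) u) = cnj (cinner u (noise w b j f v))"
    unfolding noise_def delayed_def cinner_sum_right cinner_diff_right cinner_scaleC_right adj'
    by simp
  then show ?thesis by (metis cinner_commute)
qed

lemma L2_sum: "(\<And>i. i \<in> I \<Longrightarrow> F i \<in> L2) \<Longrightarrow> (\<lambda>t. \<Sum>i\<in>I. F i t) \<in> L2"
  by (induction I rule: infinite_finite_induct) (auto intro: L2_add simp: L2_zero)

lemma (in input_field) bd_sum:
  assumes "\<And>i. i \<in> I \<Longrightarrow> F i \<in> L2"
  shows "bd (\<lambda>t. \<Sum>i\<in>I. F i t) v = (\<Sum>i\<in>I. bd (F i) v)"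
  using assms
proof (induction I rule: infinite_finite_induct)
  case (insert i I)
  then show ?case
    using bd_smear[of "F i" "\<lambda>t. \<Sum>i\<in>I. F i t" 1 1 v] by (simp add: L2_sum)
qed (use bd_smear[OF L2_zero L2_zero, of 0 0 v] in auto)

lemma (in input_field) noise_convolution:
  assumes "f \<in> L2"
  shows "noise w bd j f v = bd (\<lambda>\<nu>. eta w j (\<lambda>u. f (\<nu> + u))) v"
proof -
  let ?R = "\<lambda>n. complex_of_real (sqrt (gamma_R w j n))"
  let ?L = "\<lambda>n. complex_of_real (sqrt (gamma_L w j n))"
  let ?F = "\<lambda>n t. ?R n * f (t + travel_time w j n) + - ?L n * f (t + - travel_time w j n)"
  have "?F n \<in> L2" for n
    by (intro L2_add L2_scale L2_shift assms)
  then have "bd (\<lambda>t. \<Sum>n = 1..points w j. ?F n t) v = (\<Sum>n = 1..points w j. bd (?F n) v)"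
    by (rule bd_sum)
  also have "\<dots> = noise w bd j f v"
    unfolding noise_def delayed_def
    by (intro sum.cong refl, subst bd_smear[OF L2_shift[OF assms] L2_shift[OF assms]]) simp
  finally show ?thesis by (simp add: eta_def delta_def)
qed

end

theory Submission
  imports Defs
begin

text \<open>Each noise channel is the input field smeared with a convolution, so two channels commute up to
  the integral of a product of two convolutions; shifting the integration variable moves the first
  convolution onto the second one and yields the kernel. The states in the matrix elements of an
  It\^o product are multiples of the vacuum in every atomic component. Annihilation operators
  kill them from the right and, through the adjoint, creation operators kill them from the left,
  so only the commutator survives.\<close>

text \<open>Domination by the sum of the squared moduli. This gives the integrability that splitting
  integrals over the delta terms requires.\<close>

lemma L2_mult_integrable:
  assumes "f \<in> L2" "g \<in> L2"
  shows "integrable lborel (\<lambda>x. f x * g x)"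
proof -
  have f: "f \<in> borel_measurable borel" "integrable lborel (\<lambda>x. (cmod (f x))\<^sup>2)"
    and g: "g \<in> borel_measurable borel" "integrable lborel (\<lambda>x. (cmod (g x))\<^sup>2)"
    using assms by (auto simp: L2_def)
  have "norm (f x * g x) \<le> norm ((cmod (f x))\<^sup>2 + (cmod (g x))\<^sup>2)" for x
  proof -
    have "0 \<le> cmod (f x) * cmod (g x)" by simp
    then show ?thesis
      using sum_squares_bound[of "cmod (f x)" "cmod (g x)"] unfolding norm_mult real_norm_def by linarith
  qed
  then show ?thesis
    using f g by (intro Bochner_Integration.integrable_bound[OF Bochner_Integration.integrable_add[OF f(2) g(2)]]) auto
qed

lemma L2_diff:
  assumes "f \<in> L2" "g \<in> L2" shows "(\<lambda>t. f t - g t) \<in> L2"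
  using L2_add[OF assms(1) L2_scale[OF assms(2), of "-1"]] by simp

lemma eta_convolution_L2:
  assumes "f \<in> L2" shows "(\<lambda>\<nu>. eta w j (\<lambda>u. f (\<nu> + u))) \<in> L2"
  unfolding eta_def delta_def
  by (intro L2_sum L2_diff L2_scale L2_shift assms)

text \<open>The weights of the point masses are real square roots, so the conjugation in the kernel
  has no effect.\<close>

lemma dist_cnj_eta: "dist_cnj (eta w j) = eta w j"
  by (simp add: fun_eq_iff dist_cnj_def eta_def delta_def)

text \<open>Translation invariance of Lebesgue measure. No integrability is assumed, since the
  Bochner integral takes the same default value 0 on both sides.\<close>

lemma integral_shift_mult:
  fixes f h :: "real \<Rightarrow> complex"
  shows "(LINT t|lborel. f (t + a) * h t) = (LINT s|lborel. f s * h (s - a))"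
  using lborel_integral_real_affine[of 1 "\<lambda>s. f s * h (s - a)" a]
  by (simp add: add.commute)

text \<open>The transpose of convolution with \<open>eta w j\<close> is convolution with the
  reflected kernel: each point mass is a shift, and its transpose is the opposite shift.\<close>

lemma integral_eta_convolution_mult:
  assumes f: "f \<in> L2" and h: "h \<in> L2"
  shows "(LINT t|lborel. eta w j (\<lambda>u. f (t + u)) * h t)
    = (LINT s|lborel. f s * eta w j (\<lambda>u. h (s - u)))"
proof -
  let ?R = "\<lambda>n. complex_of_real (sqrt (gamma_R w j n))"
  let ?L = "\<lambda>n. complex_of_real (sqrt (gamma_L w j n))"
  let ?\<tau> = "travel_time w j"
  have int1: "integrable lborel (\<lambda>t. f (t + a) * h t)" for a
    by (intro L2_mult_integrable L2_shift f h)
  have int2: "integrable lborel (\<lambda>s. f s * h (s - a))" for a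
    using L2_mult_integrable[OF f L2_shift[OF h, of "- a"]] by simp
  have "(LINT t|lborel. eta w j (\<lambda>u. f (t + u)) * h t)
      = (LINT t|lborel. (\<Sum>n = 1..points w j.
          ?R n * (f (t + ?\<tau> n) * h t) - ?L n * (f (t + - ?\<tau> n) * h t)))"
    by (simp only: eta_def delta_def sum_distrib_right left_diff_distrib mult.assoc)
  also have "\<dots> = (\<Sum>n = 1..points w j.
      ?R n * (LINT t|lborel. f (t + ?\<tau> n) * h t) - ?L n * (LINT t|lborel. f (t + - ?\<tau> n) * h t))"
    by (subst Bochner_Integration.integral_sum)
       (intro Bochner_Integration.integrable_diff integrable_mult_right int1,
        subst Bochner_Integration.integral_diff[OF integrable_mult_right[OF int1] integrable_mult_right[OF int1]],
        simp only: integral_mult_right_zero)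
  also have "\<dots> = (\<Sum>n = 1..points w j.
      ?R n * (LINT s|lborel. f s * h (s - ?\<tau> n)) - ?L n * (LINT s|lborel. f s * h (s - - ?\<tau> n)))"
    by (simp only: integral_shift_mult)
  also have "\<dots> = (LINT s|lborel. (\<Sum>n = 1..points w j.
          ?R n * (f s * h (s - ?\<tau> n)) - ?L n * (f s * h (s - - ?\<tau> n))))"
    by (subst Bochner_Integration.integral_sum)
       (intro Bochner_Integration.integrable_diff integrable_mult_right int2,
        subst Bochner_Integration.integral_diff[OF integrable_mult_right[OF int2] integrable_mult_right[OF int2]],
        simp only: integral_mult_right_zero)
  also have "\<dots> = (LINT s|lborel. f s * eta w j (\<lambda>u. h (s - u)))"
    by (simp add: eta_def delta_def sum_distrib_left algebra_simps)
  finally show ?thesis .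
qed

context input_field
begin

lemma b_sum:
  assumes "\<And>i. i \<in> I \<Longrightarrow> F i \<in> L2"
  shows "b (\<lambda>t. \<Sum>i\<in>I. F i t) v = (\<Sum>i\<in>I. b (F i) v)"
  using assms
proof (induction I rule: infinite_finite_induct)
  case (insert i I)
  then show ?case
    using b_smear[of "F i" "\<lambda>t. \<Sum>i\<in>I. F i t" 1 1 v] by (simp add: L2_sum)
\<comment> \<open>Empty and infinite index sets both give the sum 0; coefficients 0 in
  \<open>b_smear\<close> show that \<open>b\<close> of the zero function vanishes.\<close>
qed (use b_smear[OF L2_zero L2_zero, of 0 0 v] in auto)

lemma noise_annihilation_convolution:
  assumes "f \<in> L2"
  shows "noise w b j f v = b (\<lambda>\<nu>. eta w j (\<lambda>u. f (\<nu> + u))) v"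
proof -
  let ?R = "\<lambda>n. complex_of_real (sqrt (gamma_R w j n))"
  let ?L = "\<lambda>n. complex_of_real (sqrt (gamma_L w j n))"
  \<comment> \<open>The minus sign goes into the second coefficient so that each summand has the
    shape of \<open>b_smear\<close>.\<close>
  let ?F = "\<lambda>n t. ?R n * f (t + travel_time w j n) + - ?L n * f (t + - travel_time w j n)"
  have "?F n \<in> L2" for n
    by (intro L2_add L2_scale L2_shift assms)
  then have "b (\<lambda>t. \<Sum>n = 1..points w j. ?F n t) v = (\<Sum>n = 1..points w j. b (?F n) v)"
    by (rule b_sum)
  also have "\<dots> = noise w b j f v"
    unfolding noise_def delayed_def
    by (intro sum.cong refl, subst b_smear[OF L2_shift[OF assms] L2_shift[OF assms]]) simp
  finally show ?thesis by (simp add: eta_def delta_def)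
qed

lemma noise_commutator_eta_kernel:
  assumes f: "f \<in> L2" and g: "g \<in> L2"
  shows "noise_commutator w b bd j l f g v = eta_kernel w j l f g *\<^sub>C v"
proof -
  let ?F = "\<lambda>\<nu>. eta w j (\<lambda>u. f (\<nu> + u))" and ?G = "\<lambda>\<nu>. eta w l (\<lambda>u. g (\<nu> + u))"
  have "noise_commutator w b bd j l f g v = commutator (b ?F) (bd ?G) v"
    unfolding noise_commutator_def commutator_def
    by (simp only: noise_annihilation_convolution[OF f] noise_convolution[OF g])
  also have "\<dots> = (LINT t|lborel. ?F t * ?G t) *\<^sub>C v"
    by (intro ccr eta_convolution_L2 f g)
  \<comment> \<open>\<open>formal_integral\<close> evaluates every delta term without a cutoff at 0
    or \<open>s\<close>, so it agrees with the integral over the whole line.\<close>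
  also have "(LINT t|lborel. ?F t * ?G t) = eta_kernel w j l f g"
    unfolding eta_kernel_def formal_integral_def dist_cnj_eta
    by (rule integral_eta_convolution_mult[OF f eta_convolution_L2[OF g]])
  finally show ?thesis .
qed

lemma noise_annihilates_vacuum:
  assumes "f \<in> L2"
  shows "noise w b j f (a *\<^sub>C vac) = 0"
  using eta_convolution_L2[OF assms, of w j]
  by (simp add: noise_annihilation_convolution assms vacuum
      module_hom.scale[OF Vector_Spaces.linear.axioms(3)[OF b_linear]])

lemma noise_annihilation_zero: "f \<in> L2 \<Longrightarrow> noise w b j f 0 = 0"
  using noise_annihilates_vacuum[of f w j 0] by simp

text \<open>Needed for the reversed product in the commutator, where creation acts on a vector
  already annihilated.\<close>

lemma noise_creation_zero:
  assumes "f \<in> L2"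
  shows "noise w bd j f 0 = 0"
proof -
  have "Vector_Spaces.linear (*\<^sub>C) (*\<^sub>C) (bd (\<lambda>\<nu>. eta w j (\<lambda>u. f (\<nu> + u))))"
    by (intro bd_linear eta_convolution_L2 assms)
  from module_hom.scale[OF Vector_Spaces.linear.axioms(3)[OF this], of 0 0] show ?thesis
    by (simp add: noise_convolution assms)
qed

text \<open>Since \<open>v\<close> is arbitrary, a creation increment on the left suffices, whatever
  stands to its right.\<close>

lemma vacuum_cinner_noise_creation:
  assumes "f \<in> L2"
  shows "cinner (a *\<^sub>C vac) (noise w bd j f v) = 0"
proof -
  have "cinner v (noise w b j (\<lambda>t. cnj (f t)) (a *\<^sub>C vac)) = cinner (noise w bd j f v) (a *\<^sub>C vac)"
    using noise_adjoint[OF L2_cnj[OF assms]] by simp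
  then have "cinner (noise w bd j f v) (a *\<^sub>C vac) = 0"
    by (simp add: noise_annihilates_vacuum L2_cnj assms cinner_zero_right)
  then show ?thesis
    by (metis cinner_commute complex_cnj_zero)
qed

end

text \<open>Atomic operators change only the atomic coefficients, so every test state keeps the
  field factor \<open>v\<close>.\<close>

lemma atomic_op_tensor:
  "atomic_op N A (tensor \<psi> v) = tensor (\<lambda>S. \<Sum>T\<in>Pow {1..N}. A S T * \<psi> T) v"
  by (simp add: atomic_op_def tensor_def scaleC_scaleC scaleC.scale_sum_left)

lemma ito_eq_tensorI:
  assumes "\<And>\<phi> \<xi> S. cinner (tensor \<phi> v S) (P (tensor \<xi> v) S) = cinner (tensor \<phi> v S) (Q (tensor \<xi> v) S)"
  shows "ito_eq N (tensor \<psi> v) P Q"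
  unfolding ito_eq_def joint_inner_def atomic_op_tensor
  by (intro allI sum.cong refl assms)

theorem theorem3:
  fixes w :: waveguide
    and b bd :: "(real \<Rightarrow> complex) \<Rightarrow> 'h \<Rightarrow> 'h::complex_pre_hilbert"
    and vac :: 'h
    and \<psi>\<^sub>0 :: "nat set \<Rightarrow> complex"
    and \<Psi>\<^sub>0 :: "'h joint"
    and j l :: nat
    and t dt :: real
  assumes "valid_waveguide w"
    and "input_field b bd vac"
    and "(\<Sum>S\<in>Pow {1..atoms w}. (cmod (\<psi>\<^sub>0 S))\<^sup>2) = 1"
    and "\<Psi>\<^sub>0 = tensor \<psi>\<^sub>0 vac"
    and "j \<in> {1..atoms w}" and "l \<in> {1..atoms w}"
    and "0 \<le> t" and "0 < dt" and "dt < position w 1 1 / speed w"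
  shows "ito_eq (atoms w) \<Psi>\<^sub>0
           (dB w b j t dt \<circ> dB w bd l t dt)
           (field_op (noise_commutator w b bd j l (window t dt) (window t dt)))
       \<and> (\<forall>f\<in>L2. \<forall>g\<in>L2. \<forall>v. noise_commutator w b bd j l f g v = eta_kernel w j l f g *\<^sub>C v)
       \<and> ito_eq (atoms w) \<Psi>\<^sub>0 (dB w b j t dt \<circ> dB w b l t dt) (\<lambda>_ _. 0)
       \<and> ito_eq (atoms w) \<Psi>\<^sub>0 (dB w bd j t dt \<circ> dB w bd l t dt) (\<lambda>_ _. 0)
       \<and> ito_eq (atoms w) \<Psi>\<^sub>0 (dB w bd l t dt \<circ> dB w b j t dt) (\<lambda>_ _. 0)"
proof -
  interpret input_field b bd vac by fact
  note W = window_L2[of t dt]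
  have "ito_eq (atoms w) \<Psi>\<^sub>0 (dB w b j t dt \<circ> dB w bd l t dt)
      (field_op (noise_commutator w b bd j l (window t dt) (window t dt)))"
    unfolding \<open>\<Psi>\<^sub>0 = _\<close>
    by (rule ito_eq_tensorI)
       \<comment> \<open>On multiples of the vacuum the subtracted term of the commutator is 0, so
         product and commutator agree even as vectors.\<close>
       (simp add: dB_def field_op_def tensor_def noise_commutator_def commutator_def
          noise_annihilates_vacuum[OF W] noise_creation_zero[OF W])
  moreover have "ito_eq (atoms w) \<Psi>\<^sub>0 (dB w b j t dt \<circ> dB w b l t dt) (\<lambda>_ _. 0)"
    unfolding \<open>\<Psi>\<^sub>0 = _\<close>
    by (rule ito_eq_tensorI)
       (simp add: dB_def field_op_def tensor_def noise_annihilates_vacuum[OF W]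
          noise_annihilation_zero[OF W])
  moreover have "ito_eq (atoms w) \<Psi>\<^sub>0 (dB w bd j t dt \<circ> dB w bd l t dt) (\<lambda>_ _. 0)"
    unfolding \<open>\<Psi>\<^sub>0 = _\<close>
    by (rule ito_eq_tensorI)
       (simp add: dB_def field_op_def tensor_def vacuum_cinner_noise_creation[OF W] cinner_zero_right)
  moreover have "ito_eq (atoms w) \<Psi>\<^sub>0 (dB w bd l t dt \<circ> dB w b j t dt) (\<lambda>_ _. 0)"
    unfolding \<open>\<Psi>\<^sub>0 = _\<close>
    by (rule ito_eq_tensorI)
       \<comment> \<open>In normal order the creation increment on the left already makes the matrix
         element vanish.\<close>
       (simp add: dB_def field_op_def tensor_def vacuum_cinner_noise_creation[OF W] cinner_zero_right)
  ultimately show ?thesis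
    by (simp add: noise_commutator_eta_kernel)
qed

end
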